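(* The cubic hypersurface in $\mathbb{P}^4_{\mathbb{C}}$, with homogeneous coordinates $f_1,\dots,f_5$, defined by $$5\sigma_1^3-18\sigma_1\sigma_2+27\sigma_3=0,$$ where $\sigma_i=\sigma_i(f_1,\dots,f_5)$ is the degree $i$ elementary symmetric polynomial, is (up to a linear change of coordinates) the Segre cubic.
   Context: The Segre cubic is the cubic threefold $$\{[y_1:\cdots:y_6]\in\mathbb{P}^5_{\mathbb{C}}: y_1+\cdots+y_6=0,\ y_1^3+\cdots+y_6^3=0\},$$ regarded as a cubic hypersurface in the hyperplane $\{y_1+\cdots+y_6=0\}\cong\mathbb{P}^4_{\mathbb{C}}$. *)

theory Defs
  imports "HOL-Analysis.Analysis"
begin

text \<open>Points of projective space are the lines through the origin; all vector space notions are
  those of the complex vector space \<open>complex ^ 'n\<close> with scaling \<open>*s\<close>.\<close>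

definition proj_space :: "(complex ^ 'n) set set" where
  "proj_space = {vec.span {v} | v. v \<noteq> 0}"

text \<open>The equations \<open>F\<close> are meant to be homogeneous, so that vanishing on a whole line is the same as
  vanishing at one of its nonzero vectors.\<close>

definition proj_zeros :: "(complex ^ 'n \<Rightarrow> complex) set \<Rightarrow> (complex ^ 'n) set set" where
  "proj_zeros Fs = {p \<in> proj_space. \<forall>F\<in>Fs. \<forall>v\<in>p. F v = 0}"

definition elem_sym :: "nat \<Rightarrow> complex ^ 'n \<Rightarrow> complex" where
  "elem_sym k x = (\<Sum>I | card I = k. \<Prod>i\<in>I. x $ i)"

definition power_sum :: "nat \<Rightarrow> complex ^ 'n \<Rightarrow> complex" where
  "power_sum k x = (\<Sum>i\<in>UNIV. x $ i ^ k)"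

definition segre_hyperplane :: "(complex ^ 6) set" where
  "segre_hyperplane = {y. power_sum 1 y = 0}"

definition segre_cubic :: "(complex ^ 6) set set" where
  "segre_cubic = proj_zeros {power_sum 1, power_sum 3}"

definition sym_cubic_form :: "complex ^ 5 \<Rightarrow> complex" where
  "sym_cubic_form f =
     5 * elem_sym 1 f ^ 3 - 18 * elem_sym 1 f * elem_sym 2 f + 27 * elem_sym 3 f"

text \<open>A linear isomorphism \<open>\<phi>\<close> onto a subspace \<open>H\<close> induces the isomorphism \<open>p \<mapsto> \<phi> ` p\<close> from projective
  space onto the projective subspace of \<open>H\<close>. It identifies two hypersurfaces as schemes, and not just
  as point sets, if it also matches their defining forms up to a nonzero constant.\<close>

definition linear_coordinate_change ::
  "(complex ^ 'n \<Rightarrow> complex ^ 'm) \<Rightarrow> (complex ^ 'm) set \<Rightarrow> bool" where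
  "linear_coordinate_change \<phi> H \<longleftrightarrow>
     Vector_Spaces.linear (*s) (*s) \<phi> \<and> bij_betw \<phi> UNIV H"

end

theory Submission
  imports Defs
begin

text \<open>
  With \<open>s = f\<^sub>1 + \<dots> + f\<^sub>5\<close>, put \<open>y\<^sub>6 = - s / 6\<close> and \<open>y\<^sub>i = f\<^sub>i - s / 6\<close> for \<open>i \<le> 5\<close>. The \<open>y\<close>'s sum to
  zero and \<open>f\<^sub>i = y\<^sub>i - y\<^sub>6\<close> recovers \<open>f\<close>. An \<open>S\<^sub>5\<close>-equivariant substitution \<open>y\<^sub>i = f\<^sub>i + a s\<close>,
  \<open>y\<^sub>6 = - (1 + 5 a) s\<close> gives, by Newton's identities,
  \<open>\<Sum> y\<^sub>i\<^sup>3 = 3 \<sigma>\<^sub>3 - (3 + 6 a) \<sigma>\<^sub>1 \<sigma>\<^sub>2 + (1 + 3 a + 3 a\<^sup>2 + 5 a\<^sup>3 - (1 + 5 a)\<^sup>3) \<sigma>\<^sub>1\<^sup>3\<close>, and comparing the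
  first two coefficients forces \<open>a = - 1 / 6\<close> and the proportionality constant \<open>1 / 9\<close>.
\<close>

text \<open>The index set is a parameter, instead of a whole type as in \<open>elem_sym\<close>, so
  that identities can be proved by induction on it.\<close>

definition elem_sym_on :: "nat \<Rightarrow> ('i \<Rightarrow> 'a::comm_ring_1) \<Rightarrow> 'i set \<Rightarrow> 'a" where
  "elem_sym_on k x A = (\<Sum>I | I \<subseteq> A \<and> card I = k. \<Prod>i\<in>I. x i)"

lemma elem_sym_eq_elem_sym_on: "elem_sym k x = elem_sym_on k (($) x) UNIV"
  by (simp add: elem_sym_def elem_sym_on_def)

lemma elem_sym_on_0:
  assumes "finite A"
  shows "elem_sym_on 0 x A = 1"
proof -
  have "{I. I \<subseteq> A \<and> card I = 0} = {{}}"
    using assms by (auto dest: finite_subset)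
  then show ?thesis by (simp add: elem_sym_on_def)
qed

lemma elem_sym_on_Suc_empty: "elem_sym_on (Suc k) x {} = 0"
proof -
  have "{I. I \<subseteq> {} \<and> card I = Suc k} = {}" by auto
  then show ?thesis unfolding elem_sym_on_def by (metis sum.empty)
qed

text \<open>The subsets of size \<open>Suc k\<close> are split by whether they contain
  \<open>a\<close>; those that do correspond to the \<open>k\<close>-subsets of \<open>A\<close>,
  each contributing an extra factor \<open>x a\<close>.\<close>

lemma elem_sym_on_Suc_insert:
  assumes fin: "finite A" and a: "a \<notin> A"
  shows "elem_sym_on (Suc k) x (insert a A) = elem_sym_on (Suc k) x A + x a * elem_sym_on k x A"
proof -
  let ?S = "\<lambda>k. {I. I \<subseteq> A \<and> card I = k}"
  have fin_mem: "finite I" if "I \<subseteq> A" for I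
    using that fin finite_subset by blast
  have split: "{I. I \<subseteq> insert a A \<and> card I = Suc k} = ?S (Suc k) \<union> insert a ` ?S k"
  proof (intro set_eqI iffI)
    fix I
    assume I: "I \<in> {I. I \<subseteq> insert a A \<and> card I = Suc k}"
    show "I \<in> ?S (Suc k) \<union> insert a ` ?S k"
    proof (cases "a \<in> I")
      case True
      then have "I = insert a (I - {a})" by auto
      moreover have "I - {a} \<in> ?S k" using I True by auto
      ultimately show ?thesis by blast
    next
      case False
      then show ?thesis using I by auto
    qed
  next
    fix I
    assume "I \<in> ?S (Suc k) \<union> insert a ` ?S k"
    then show "I \<in> {I. I \<subseteq> insert a A \<and> card I = Suc k}"
      using a fin_mem by (auto simp: card_insert_if)
  qed
  have inj: "inj_on (insert a) (?S k)"
    using a by (intro inj_onI) (metis (mono_tags) insert_ident mem_Collect_eq subsetD)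
  have "elem_sym_on (Suc k) x (insert a A)
      = elem_sym_on (Suc k) x A + (\<Sum>I\<in>insert a ` ?S k. prod x I)"
    unfolding elem_sym_on_def split using fin a by (intro sum.union_disjoint) auto
  also have "(\<Sum>I\<in>insert a ` ?S k. prod x I) = (\<Sum>I\<in>?S k. prod x (insert a I))"
    by (simp add: sum.reindex[OF inj])
  also have "\<dots> = (\<Sum>I\<in>?S k. x a * prod x I)"
    using a fin_mem by (intro sum.cong) (auto intro!: prod.insert)
  finally show ?thesis
    by (simp add: elem_sym_on_def sum_distrib_left)
qed

lemma elem_sym_on_1:
  assumes "finite A"
  shows "elem_sym_on (Suc 0) x A = sum x A"
  using assms
  by (induction A) (simp_all add: elem_sym_on_Suc_empty elem_sym_on_Suc_insert elem_sym_on_0)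

lemma sum_squares_eq_elem_sym_on:
  assumes "finite A"
  shows "(\<Sum>i\<in>A. x i ^ 2) = sum x A ^ 2 - 2 * elem_sym_on (Suc (Suc 0)) x A"
  using assms
proof (induction A)
  case (insert a A)
  then show ?case
    by (simp add: elem_sym_on_Suc_insert elem_sym_on_1 power2_eq_square power3_eq_cube algebra_simps)
qed (simp add: elem_sym_on_Suc_empty)

text \<open>Newton's identity in degree three. By the insertion recurrence, the induction step is a
  ring identity in \<open>x a\<close> and the first three elementary symmetric functions on
  \<open>A\<close>. Degrees are written with \<open>Suc\<close> so that the recurrence
  applies.\<close>

lemma sum_cubes_eq_elem_sym_on:
  assumes "finite A"
  shows "(\<Sum>i\<in>A. x i ^ 3) = sum x A ^ 3 - 3 * sum x A * elem_sym_on (Suc (Suc 0)) x A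
    + 3 * elem_sym_on (Suc (Suc (Suc 0))) x A"
  using assms
proof (induction A)
  case (insert a A)
  then show ?case
    by (simp add: elem_sym_on_Suc_insert elem_sym_on_1 power2_eq_square power3_eq_cube algebra_simps)
qed (simp add: elem_sym_on_Suc_empty)

lemma elem_sym_1: "elem_sym 1 x = (\<Sum>i\<in>UNIV. x $ i)"
  by (simp add: elem_sym_eq_elem_sym_on elem_sym_on_1)

lemma power_sum_2: "power_sum 2 x = elem_sym 1 x ^ 2 - 2 * elem_sym 2 x"
  using sum_squares_eq_elem_sym_on[of UNIV "($) x"]
  by (simp add: power_sum_def elem_sym_eq_elem_sym_on elem_sym_on_1 numeral_2_eq_2)

lemma power_sum_3:
  "power_sum 3 x = elem_sym 1 x ^ 3 - 3 * elem_sym 1 x * elem_sym 2 x + 3 * elem_sym 3 x"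
  using sum_cubes_eq_elem_sym_on[of UNIV "($) x"]
  by (simp add: power_sum_def elem_sym_eq_elem_sym_on elem_sym_on_1 numeral_2_eq_2 numeral_3_eq_3)

text \<open>An injective linear map sends lines to lines, and by \<open>zeros\<close> it respects
  the equations vector by vector. Assumption \<open>H\<close> gives surjectivity: a line in the zero
  set of \<open>Gs\<close> is spanned by a vector in the range of \<open>\<phi>\<close>.\<close>

lemma linear_coordinate_change_proj_zeros:
  assumes \<phi>: "linear_coordinate_change \<phi> H"
    and zeros: "\<And>v. (\<forall>F\<in>Fs. F v = 0) \<longleftrightarrow> (\<forall>G\<in>Gs. G (\<phi> v) = 0)"
    and H: "\<And>w. \<forall>G\<in>Gs. G w = 0 \<Longrightarrow> w \<in> H"
  shows "(\<lambda>p. \<phi> ` p) ` proj_zeros Fs = proj_zeros Gs"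
proof -
  have lin: "Vector_Spaces.linear (*s) (*s) \<phi>" and inj: "inj \<phi>" and surj: "range \<phi> = H"
    using \<phi> by (auto simp: linear_coordinate_change_def bij_betw_def)
  have span: "\<phi> ` vec.span {v} = vec.span {\<phi> v}" for v
    using vec.linear_span_image[OF lin, of "{v}"] by simp
  have nz: "\<phi> v = 0 \<longleftrightarrow> v = 0" for v
    using inj vec.linear_0[OF lin] by (metis injD)
  have mem: "vec.span {v} \<in> proj_zeros Fs \<longleftrightarrow> \<phi> ` vec.span {v} \<in> proj_zeros Gs"
    if "v \<noteq> 0" for v
  proof -
    have "vec.span {v} \<in> proj_space" "\<phi> ` vec.span {v} \<in> proj_space"
      using that nz by (auto simp: proj_space_def span)
    then show ?thesis
      using zeros by (auto simp: proj_zeros_def)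
  qed
  show ?thesis
  proof (intro equalityI subsetI)
    fix q
    assume "q \<in> (\<lambda>p. \<phi> ` p) ` proj_zeros Fs"
    then show "q \<in> proj_zeros Gs"
      using mem by (force simp: proj_zeros_def[of Fs] proj_space_def)
  next
    fix q
    assume q: "q \<in> proj_zeros Gs"
    then obtain w where w: "q = vec.span {w}" "w \<noteq> 0"
      by (auto simp: proj_zeros_def proj_space_def)
    then have "\<forall>G\<in>Gs. G w = 0"
      using q vec.span_base[of w "{w}"] by (auto simp: proj_zeros_def)
    then obtain v where v: "w = \<phi> v"
      using H surj by blast
    with w nz have "v \<noteq> 0" "q = \<phi> ` vec.span {v}"
      by (auto simp: span)
    with mem q show "q \<in> (\<lambda>p. \<phi> ` p) ` proj_zeros Fs" by blast
  qed
qed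

theorem corollary11:
  "\<exists>\<phi> :: complex ^ 5 \<Rightarrow> complex ^ 6.
     linear_coordinate_change \<phi> segre_hyperplane \<and>
     (\<lambda>p. \<phi> ` p) ` proj_zeros {sym_cubic_form} = segre_cubic \<and>
     (\<exists>c. c \<noteq> 0 \<and> (\<forall>f. power_sum 3 (\<phi> f) = c * sym_cubic_form f))"
proof -
  \<comment> \<open>In the numeral type \<open>6\<close> the index 6 is \<open>0\<close>, so
    coordinate \<open>0\<close> plays the role of \<open>y\<^sub>6\<close>. Any bijection
    \<open>k\<close> of the other indices with the type \<open>5\<close> will do, since all forms
    involved are symmetric.\<close>
  have card: "card (- {0 :: 6}) = 5"
    by (simp add: Compl_eq_Diff_UNIV card_Diff_singleton)
  then obtain k :: "6 \<Rightarrow> 5" where k: "bij_betw k (- {0}) UNIV"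
    using finite_same_card_bij[of "- {0 :: 6}" "UNIV :: 5 set"] by auto
  define \<phi> :: "complex ^ 5 \<Rightarrow> complex ^ 6"
    where "\<phi> f = (\<chi> j. (if j = 0 then 0 else f $ k j) - (\<Sum>i\<in>UNIV. f $ i) / 6)" for f
  have sum6: "(\<Sum>j\<in>UNIV. g j) = g 0 + (\<Sum>j\<in>- {0}. g j)" for g :: "6 \<Rightarrow> complex"
    by (simp add: sum.remove[of UNIV 0] Compl_eq_Diff_UNIV)
  have reindex: "(\<Sum>j\<in>- {0}. g (k j)) = (\<Sum>i\<in>UNIV. g i)" for g :: "5 \<Rightarrow> complex"
    by (rule sum.reindex_bij_betw[OF k])
  have power_sum_\<phi>: "power_sum n (\<phi> f)
      = (- (\<Sum>i\<in>UNIV. f $ i) / 6) ^ n + (\<Sum>i\<in>UNIV. (f $ i - (\<Sum>i\<in>UNIV. f $ i) / 6) ^ n)" for n f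
    unfolding power_sum_def sum6 reindex[symmetric, of "\<lambda>i. (f $ i - _) ^ n"]
    by (auto simp: \<phi>_def intro!: sum.cong)
  have \<phi>_1: "power_sum 1 (\<phi> f) = 0" for f
    unfolding power_sum_\<phi> by (simp add: sum_subtractf)
  have \<phi>_3: "power_sum 3 (\<phi> f) = 1 / 9 * sym_cubic_form f" for f
  proof -
    let ?s = "elem_sym 1 f"
    have cube: "(f $ i - ?s / 6) ^ 3 = f $ i ^ 3 - ?s / 2 * f $ i ^ 2 + ?s ^ 2 / 12 * f $ i - ?s ^ 3 / 216"
      for i
      by (simp add: power2_eq_square power3_eq_cube field_simps)
    have "power_sum 3 (\<phi> f) = (- ?s / 6) ^ 3 + (\<Sum>i\<in>UNIV. (f $ i - ?s / 6) ^ 3)"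
      by (simp only: power_sum_\<phi> elem_sym_1)
    also have "(\<Sum>i\<in>UNIV. (f $ i - ?s / 6) ^ 3)
        = power_sum 3 f - ?s / 2 * power_sum 2 f + ?s ^ 2 / 12 * (\<Sum>i\<in>UNIV. f $ i) - 5 * (?s ^ 3 / 216)"
      unfolding cube sum.distrib sum_subtractf sum_distrib_left[symmetric] power_sum_def by simp
    \<comment> \<open>The coefficient of \<open>\<sigma>\<^sub>1\<^sup>3\<close> is -1/216 + 1 - 1/2
      + 1/12 - 5/216 = 5/9; that of \<open>\<sigma>\<^sub>1 \<sigma>\<^sub>2\<close> is -3 + 1 = -2,
      and that of \<open>\<sigma>\<^sub>3\<close> is 3.\<close>
    also have "(- ?s / 6) ^ 3 + \<dots> = 1 / 9 * sym_cubic_form f"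
      unfolding elem_sym_1[symmetric] power_sum_2 power_sum_3 sym_cubic_form_def
      by (simp add: power2_eq_square power3_eq_cube field_simps)
    finally show ?thesis .
  qed
  have lin: "Vector_Spaces.linear (*s) (*s) \<phi>"
    by (auto simp: Vector_Spaces.linear_iff vec.vector_space_axioms \<phi>_def vec_eq_iff sum.distrib
        sum_distrib_left[symmetric] field_simps)
  have inj: "inj \<phi>"
  proof (rule injI)
    fix f g
    assume eq: "\<phi> f = \<phi> g"
    \<comment> \<open>Both coordinates carry the same shift, which cancels in the
      difference.\<close>
    have "f $ i = \<phi> f $ inv_into (- {0}) k i - \<phi> f $ 0" for f i
      using bij_betw_inv_into_right[OF k, of i] bij_betw_apply[OF bij_betw_inv_into[OF k], of i]
      by (simp add: \<phi>_def)
    with eq show "f = g" by (metis vec_eq_iff)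
  qed
  have surj: "range \<phi> = segre_hyperplane"
  proof (intro equalityI subsetI)
    fix y
    assume "y \<in> segre_hyperplane"
    then have y: "(\<Sum>j\<in>- {0}. y $ j) = - (y $ 0)"
      using sum6[of "($) y"] by (simp add: segre_hyperplane_def power_sum_def add_eq_0_iff)
    define f where "f = (\<chi> i. y $ inv_into (- {0}) k i - y $ 0)"
    have f: "f $ k j = y $ j - y $ 0" if "j \<noteq> 0" for j
      using that bij_betw_inv_into_left[OF k] by (simp add: f_def)
    have "(\<Sum>i\<in>UNIV. f $ i) = (\<Sum>j\<in>- {0}. y $ j - y $ 0)"
      unfolding reindex[symmetric] by (intro sum.cong) (auto simp: f)
    \<comment> \<open>The hyperplane equation contributes \<open>- (y $ 0)\<close> and the five
      subtracted terms \<open>- 5 * y $ 0\<close>. Hence the shift in \<open>\<phi> f\<close> adds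
      back exactly \<open>y $ 0\<close>.\<close>
    also have "\<dots> = - 6 * y $ 0"
      by (simp add: sum_subtractf y card)
    finally have "\<phi> f = y"
      by (auto simp: \<phi>_def vec_eq_iff f)
    then show "y \<in> range \<phi>" by blast
  qed (use \<phi>_1 in \<open>auto simp: segre_hyperplane_def\<close>)
  have change: "linear_coordinate_change \<phi> segre_hyperplane"
    using lin inj surj by (simp add: linear_coordinate_change_def bij_betw_def)
  \<comment> \<open>On the image of \<open>\<phi>\<close> the linear equation holds identically, and
    the cubic one is a nonzero multiple of \<open>sym_cubic_form\<close>.\<close>
  have "(\<lambda>p. \<phi> ` p) ` proj_zeros {sym_cubic_form} = segre_cubic"
    unfolding segre_cubic_def using \<phi>_1
    by (intro linear_coordinate_change_proj_zeros[OF change]) (auto simp: \<phi>_3 segre_hyperplane_def)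
  moreover have "\<exists>c. c \<noteq> 0 \<and> (\<forall>f. power_sum 3 (\<phi> f) = c * sym_cubic_form f)"
    using \<phi>_3 by (intro exI[of _ "1 / 9"]) simp
  ultimately show ?thesis
    using change by blast
qed

end
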